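(* For all $i,j\in\{1,\dots,U\}$, the $(i,j)$-th element of the decoupled covariance matrix $\mathbf{R}_{\mathrm d}=\mathbf{R}\odot\mathbf{R}_{\mathrm a}$ satisfies $$[\mathbf{R}_{\mathrm d}]_{i,j}=\sum_{k=1}^{K}\exp[P_{i,j}(\theta_k)+Q_{i,j}(\theta_k,r_k)]\times\sum_{k=1}^{K}\exp[P_{i,j}(\theta_k)-Q_{i,j}(\theta_k,r_k)]=[\mathbf{S}]_{i,j}+[\mathbf{C}]_{i,j},$$ where $\mathbf{S},\mathbf{C}\in\mathbb{C}^{U\times U}$ (the self-spectrum matrix and the cross-spectrum matrix) are defined by $$[\mathbf{S}]_{i,j}=\sum_{k=1}^{K}\exp[2P_{i,j}(\theta_k)],$$ $$[\mathbf{C}]_{i,j}=\sum_{w=1}^{K}\ \sum_{u=1,\,u\neq w}^{K}\exp\big[P_{i,j}(\theta_u)+P_{i,j}(\theta_w)+Q_{i,j}(\theta_u,r_u)-Q_{i,j}(\theta_w,r_w)\big].$$ Moreover, $$\mathbf{S}=\mathbf{A}(\theta)\mathbf{A}^{H}(\theta)=\sum_{k=1}^{K}\mathbf{a}(\theta_k)\mathbf{a}^{H}(\theta_k),$$ where $\mathbf{A}(\theta)=[\mathbf{a}(\theta_1),\dots,\mathbf{a}(\theta_K)]\in\mathbb{C}^{U\times K}$ and $$\mathbf{a}(\theta_k)=\left[e^{-\jmath\frac{2\pi}{\lambda}2s_1\sin\theta_k},\,e^{-\jmath\frac{2\pi}{\lambda}2s_2\sin\theta_k},\,\dots,\,e^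{-\jmath\frac{2\pi}{\lambda}2s_U\sin\theta_k}\right]^{T}.$$
   Context: Array: $M<N$ are coprime positive integers, $\lambda>0$ is the carrier wavelength, $d=\lambda/4$, $V=M+N-1$ and $U=2V-1$. The sensors of the symmetric coprime array are located at the points of $$\mathcal{S}=\{Mnd : n=-N+1,\dots,N-1\}\cup\{Nmd : m=-M+1,\dots,M-1\},$$ a set with $U$ elements, listed in ascending order as $s_1<s_2<\cdots<s_U$. Targets: there are $K\ge 1$ targets with (angle, range) pairs $(\theta_k,r_k)$, $k=1,\dots,K$, with $\theta_k$ real and $r_k>0$. All targets lie in the Fresnel near-field region, i.e. $1.2D<r_k<2D^2/\lambda$ with $D=2M(N-1)d$. Steering vectors (Fresnel-approximated model): with $\jmath$ the imaginary unit, $\mathbf{b}(\theta_k,r_k)\in\mathbb{C}^{U}$ has entries $[\mathbf{b}(\theta_k,r_k)]_u=e^{\jmath p_u(\theta_k)+\jmath q_u(\theta_k,r_k)}$, where $$p_u(\theta_k)=-\frac{2\pi s_u\sin\theta_k}{\lambda},\qquad q_u(\theta_k,r_k)=\frac{\pi s_u^2\cos^2\theta_k}{\lambda r_k}.$$ Initial covariance matrix: $\mathbf{R}=\mathbf{B}\mathbf{B}^H\in\mathbb{C}^{U\times U}$ with $\mathbf{B}=[\mathbf{b}(\theta_1,r_1),\dots,\mathbf{b}(\theta_K,r_K)]$, i.e. $\mathbf{R}=\sum_{k=1}^K\mathbf{b}(\theta_k,r_k)\mathbf{b}^H(\theta_k,r_k)$. First-order and second-order terms: $P_{i,j}(\theta_k)=\jmath\,(p_i(\theta_k)-p_j(\theta_k))$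 and $Q_{i,j}(\theta_k,r_k)=\jmath\,(q_i(\theta_k,r_k)-q_j(\theta_k,r_k))$, so that $[\mathbf{R}]_{i,j}=\sum_{k=1}^K\exp[P_{i,j}(\theta_k)+Q_{i,j}(\theta_k,r_k)]$. The matrix $\mathbf{R}_{\mathrm a}\in\mathbb{C}^{U\times U}$ is the reflection of $\mathbf{R}$ across its anti-diagonal: $[\mathbf{R}_{\mathrm a}]_{i,j}=[\mathbf{R}]_{2V-j,\,2V-i}$. The symbol $\odot$ denotes the Hadamard (entrywise) product. *)

theory Defs
  imports Complex_Main "Jordan_Normal_Form.Schur_Decomposition"
begin

text \<open>Matrices are zero-based in the library, while sensors, targets and matrix entries are
  numbered from 1 here: \<open>entry A i j\<close> is the entry in the \<open>i\<close>-th row and \<open>j\<close>-th column, and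
  \<open>mat1\<close> and \<open>vec1\<close> build a matrix or vector from its one-based entries.\<close>

definition entry :: "'a mat \<Rightarrow> nat \<Rightarrow> nat \<Rightarrow> 'a" where
  "entry A i j = A $$ (i - 1, j - 1)"

definition mat1 :: "nat \<Rightarrow> nat \<Rightarrow> (nat \<Rightarrow> nat \<Rightarrow> 'a) \<Rightarrow> 'a mat" where
  "mat1 m n f = mat m n (\<lambda>(i, j). f (i + 1) (j + 1))"

definition vec1 :: "nat \<Rightarrow> (nat \<Rightarrow> 'a) \<Rightarrow> 'a vec" where
  "vec1 n f = vec n (\<lambda>i. f (i + 1))"

lemma entry_mat1 [simp]:
  "i \<in> {1..m} \<Longrightarrow> j \<in> {1..n} \<Longrightarrow> entry (mat1 m n f) i j = f i j"
  by (auto simp: entry_def mat1_def)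

definition hadamard :: "'a::times mat \<Rightarrow> 'a mat \<Rightarrow> 'a mat" where
  "hadamard A B = mat (dim_row A) (dim_col A) (\<lambda>(i, j). A $$ (i, j) * B $$ (i, j))"

text \<open>The square matrix \<open>v v\<^sup>H\<close>, with \<open>v\<close> read as a one-column matrix.\<close>

definition outer_self :: "complex vec \<Rightarrow> complex mat" where
  "outer_self v = mat_of_cols (dim_vec v) [v] * mat_adjoint (mat_of_cols (dim_vec v) [v])"

definition spacing :: "real \<Rightarrow> real" where
  "spacing lam = lam / 4"

definition V_num :: "nat \<Rightarrow> nat \<Rightarrow> nat" where
  "V_num M N = M + N - 1"

definition U_num :: "nat \<Rightarrow> nat \<Rightarrow> nat" where
  "U_num M N = 2 * V_num M N - 1"

definition aperture :: "nat \<Rightarrow> nat \<Rightarrow> real \<Rightarrow> real" where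
  "aperture M N lam = 2 * real M * (real N - 1) * spacing lam"

definition sensors :: "nat \<Rightarrow> nat \<Rightarrow> real \<Rightarrow> real set" where
  "sensors M N lam =
     (\<lambda>n::int. real M * real_of_int n * spacing lam) ` {- int N + 1 .. int N - 1} \<union>
     (\<lambda>m::int. real N * real_of_int m * spacing lam) ` {- int M + 1 .. int M - 1}"

text \<open>The sensor positions \<open>s\<^sub>1 < \<dots> < s\<^sub>U\<close>; meaningful for \<open>u \<in> {1..U}\<close>.\<close>

definition sensor_pos :: "nat \<Rightarrow> nat \<Rightarrow> real \<Rightarrow> nat \<Rightarrow> real" where
  "sensor_pos M N lam u = sorted_list_of_set (sensors M N lam) ! (u - 1)"

lemma card_sensors:
  assumes "0 < M" "M < N" "coprime M N" "0 < lam"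
  shows "card (sensors M N lam) = U_num M N"
proof -
  let ?d = "spacing lam"
  let ?f = "\<lambda>n::int. real M * real_of_int n * ?d"
  let ?g = "\<lambda>m::int. real N * real_of_int m * ?d"
  let ?A = "{- int N + 1 .. int N - 1}" and ?B = "{- int M + 1 .. int M - 1}"
  have d: "?d > 0" using assms by (simp add: spacing_def)
  have cf: "card (?f ` ?A) = 2 * N - 1" and cg: "card (?g ` ?B) = 2 * M - 1"
    using assms d by (auto simp: card_image inj_on_def)
  have "?f ` ?A \<inter> ?g ` ?B = {0}"
  proof
    show "?f ` ?A \<inter> ?g ` ?B \<subseteq> {0}"
    proof
      fix x assume "x \<in> ?f ` ?A \<inter> ?g ` ?B"
      then obtain n m where x: "x = ?f n" and eq: "?f n = ?g m" and n: "n \<in> ?A" by blast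
      have "real_of_int (int M * n) = real_of_int (int N * m)" using eq d by simp
      then have "int M * n = int N * m" by linarith
      then have "int N dvd int M * n" by simp
      moreover have "coprime (int N) (int M)" using assms by (simp add: coprime_commute)
      ultimately have "int N dvd n" using coprime_dvd_mult_right_iff by blast
      then have "n = 0" using n dvd_imp_le_int[of n "int N"] by fastforce
      then show "x \<in> {0}" using x by simp
    qed
    show "{0} \<subseteq> ?f ` ?A \<inter> ?g ` ?B" using assms by (auto intro!: image_eqI[of _ _ 0])
  qed
  then have "card (sensors M N lam) + 1 = (2 * N - 1) + (2 * M - 1)"
    unfolding sensors_def using card_Un_Int[of "?f ` ?A" "?g ` ?B"] cf cg by simp
  then show ?thesis using assms by (simp add: U_num_def V_num_def)
qed

definition p_phase :: "nat \<Rightarrow> nat \<Rightarrow> real \<Rightarrow> nat \<Rightarrow> real \<Rightarrow> real" where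
  "p_phase M N lam u t = - (2 * pi * sensor_pos M N lam u * sin t / lam)"

definition q_phase :: "nat \<Rightarrow> nat \<Rightarrow> real \<Rightarrow> nat \<Rightarrow> real \<Rightarrow> real \<Rightarrow> real" where
  "q_phase M N lam u t \<rho> = pi * (sensor_pos M N lam u)\<^sup>2 * (cos t)\<^sup>2 / (lam * \<rho>)"

definition P_term :: "nat \<Rightarrow> nat \<Rightarrow> real \<Rightarrow> nat \<Rightarrow> nat \<Rightarrow> real \<Rightarrow> complex" where
  "P_term M N lam i j t = \<i> * complex_of_real (p_phase M N lam i t - p_phase M N lam j t)"

definition Q_term :: "nat \<Rightarrow> nat \<Rightarrow> real \<Rightarrow> nat \<Rightarrow> nat \<Rightarrow> real \<Rightarrow> real \<Rightarrow> complex" where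
  "Q_term M N lam i j t \<rho> =
     \<i> * complex_of_real (q_phase M N lam i t \<rho> - q_phase M N lam j t \<rho>)"

definition b_vec :: "nat \<Rightarrow> nat \<Rightarrow> real \<Rightarrow> real \<Rightarrow> real \<Rightarrow> complex vec" where
  "b_vec M N lam t \<rho> = vec1 (U_num M N)
     (\<lambda>u. exp (\<i> * complex_of_real (p_phase M N lam u t)
             + \<i> * complex_of_real (q_phase M N lam u t \<rho>)))"

definition a_vec :: "nat \<Rightarrow> nat \<Rightarrow> real \<Rightarrow> real \<Rightarrow> complex vec" where
  "a_vec M N lam t = vec1 (U_num M N)
     (\<lambda>u. exp (- (\<i> * complex_of_real (2 * pi / lam * (2 * sensor_pos M N lam u) * sin t))))"

text \<open>The targets are \<open>(\<theta> 1, r 1), \<dots>, (\<theta> K, r K)\<close>.\<close>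

definition B_mat ::
  "nat \<Rightarrow> nat \<Rightarrow> real \<Rightarrow> nat \<Rightarrow> (nat \<Rightarrow> real) \<Rightarrow> (nat \<Rightarrow> real) \<Rightarrow> complex mat" where
  "B_mat M N lam K \<theta> r =
     mat_of_cols (U_num M N) (map (\<lambda>k. b_vec M N lam (\<theta> k) (r k)) [1..<K + 1])"

definition A_mat :: "nat \<Rightarrow> nat \<Rightarrow> real \<Rightarrow> nat \<Rightarrow> (nat \<Rightarrow> real) \<Rightarrow> complex mat" where
  "A_mat M N lam K \<theta> =
     mat_of_cols (U_num M N) (map (\<lambda>k. a_vec M N lam (\<theta> k)) [1..<K + 1])"

definition R_mat ::
  "nat \<Rightarrow> nat \<Rightarrow> real \<Rightarrow> nat \<Rightarrow> (nat \<Rightarrow> real) \<Rightarrow> (nat \<Rightarrow> real) \<Rightarrow> complex mat" where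
  "R_mat M N lam K \<theta> r = B_mat M N lam K \<theta> r * mat_adjoint (B_mat M N lam K \<theta> r)"

definition Ra_mat ::
  "nat \<Rightarrow> nat \<Rightarrow> real \<Rightarrow> nat \<Rightarrow> (nat \<Rightarrow> real) \<Rightarrow> (nat \<Rightarrow> real) \<Rightarrow> complex mat" where
  "Ra_mat M N lam K \<theta> r = mat1 (U_num M N) (U_num M N)
     (\<lambda>i j. entry (R_mat M N lam K \<theta> r) (2 * V_num M N - j) (2 * V_num M N - i))"

definition Rd_mat ::
  "nat \<Rightarrow> nat \<Rightarrow> real \<Rightarrow> nat \<Rightarrow> (nat \<Rightarrow> real) \<Rightarrow> (nat \<Rightarrow> real) \<Rightarrow> complex mat" where
  "Rd_mat M N lam K \<theta> r = hadamard (R_mat M N lam K \<theta> r) (Ra_mat M N lam K \<theta> r)"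

definition S_mat :: "nat \<Rightarrow> nat \<Rightarrow> real \<Rightarrow> nat \<Rightarrow> (nat \<Rightarrow> real) \<Rightarrow> complex mat" where
  "S_mat M N lam K \<theta> = mat1 (U_num M N) (U_num M N)
     (\<lambda>i j. \<Sum>k = 1..K. exp (2 * P_term M N lam i j (\<theta> k)))"

definition C_mat ::
  "nat \<Rightarrow> nat \<Rightarrow> real \<Rightarrow> nat \<Rightarrow> (nat \<Rightarrow> real) \<Rightarrow> (nat \<Rightarrow> real) \<Rightarrow> complex mat" where
  "C_mat M N lam K \<theta> r = mat1 (U_num M N) (U_num M N)
     (\<lambda>i j. \<Sum>w = 1..K. \<Sum>u \<in> {1..K} - {w}.
        exp (P_term M N lam i j (\<theta> u) + P_term M N lam i j (\<theta> w)
           + Q_term M N lam i j (\<theta> u) (r u) - Q_term M N lam i j (\<theta> w) (r w)))"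

end

(*
  The sensor array is symmetric about the origin, so the reflection i -> 2V - i of indices negates
  positions.  The phase p is odd and q is even in the position; hence reflecting R across its
  anti-diagonal keeps the first-order terms P and flips the sign of the second-order terms Q.
  In the product of the two sums over targets the Q-terms cancel exactly on the diagonal.
*)
theory Submission
  imports Defs
begin

text \<open>Negation reverses the order, so negating the reversed list gives a strictly increasing
  list with the same elements, and such a list is unique.\<close>

lemma sorted_list_of_set_symmetric:
  fixes A :: "'a::linordered_ab_group_add set"
  assumes "finite A" and "uminus ` A = A"
  shows "map uminus (rev (sorted_list_of_set A)) = sorted_list_of_set A"
proof -
  have "sorted_wrt (<) (map uminus (rev (sorted_list_of_set A)))"
    by (simp add: sorted_wrt_map sorted_wrt_rev)
  moreover have "set (map uminus (rev (sorted_list_of_set A))) = A"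
    using assms by simp
  ultimately show ?thesis
    using sorted_list_of_set_unique[OF assms(1), of "map uminus (rev (sorted_list_of_set A))"]
    by simp
qed

lemma uminus_image_sensors: "uminus ` sensors M N lam = sensors M N lam"
proof -
  have neg: "- x \<in> sensors M N lam" if "x \<in> sensors M N lam" for x
  proof -
    from that consider
      n where "n \<in> {- int N + 1 .. int N - 1}" "x = real M * real_of_int n * spacing lam"
      | m where "m \<in> {- int M + 1 .. int M - 1}" "x = real N * real_of_int m * spacing lam"
      unfolding sensors_def by blast
    then show ?thesis
    proof cases
      case 1
      then show ?thesis
        unfolding sensors_def by (intro UnI1 image_eqI[of _ _ "- n"]) auto
    next
      case 2
      then show ?thesis
        unfolding sensors_def by (intro UnI2 image_eqI[of _ _ "- m"]) auto
    qed
  qed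
  \<comment> \<open>One inclusion suffices, since negation is an involution: each \<open>x\<close>
    is the image of \<open>- x\<close>.\<close>
  then show ?thesis by (force intro: image_eqI[of _ uminus "- x" for x])
qed

lemma finite_sensors: "finite (sensors M N lam)"
  by (simp add: sensors_def)

text \<open>Reversing a list of length \<open>U_num M N\<close> exchanges the zero-based positions
  \<open>u - 1\<close> and \<open>U_num M N - u\<close>. The length comes from
  \<open>card_sensors\<close>, which is where coprimality enters.\<close>

lemma sensor_pos_reflect:
  assumes "0 < M" "M < N" "coprime M N" "0 < lam" and u: "u \<in> {1..U_num M N}"
  shows "sensor_pos M N lam (2 * V_num M N - u) = - sensor_pos M N lam u"
proof -
  let ?xs = "sorted_list_of_set (sensors M N lam)"
  have len: "length ?xs = U_num M N"
    using card_sensors[OF assms(1-4)] by simp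
  have "?xs ! (u - 1) = map uminus (rev ?xs) ! (u - 1)"
    by (simp only: sorted_list_of_set_symmetric[OF finite_sensors uminus_image_sensors])
  also have "\<dots> = - (?xs ! (U_num M N - u))"
    using u len by (auto simp: rev_nth)
  \<comment> \<open>\<open>sensor_pos\<close> subtracts 1 from its one-based argument, which matches
    \<open>U = 2 * V - 1\<close>.\<close>
  also have "U_num M N - u = 2 * V_num M N - u - 1"
    by (simp add: U_num_def)
  finally show ?thesis
    by (simp add: sensor_pos_def)
qed

text \<open>Two sign changes cancel: one from exchanging \<open>i\<close> and \<open>j\<close>, one
  from the oddness of \<open>p_phase\<close> in the position.\<close>

lemma P_term_reflect:
  assumes "0 < M" "M < N" "coprime M N" "0 < lam" "i \<in> {1..U_num M N}" "j \<in> {1..U_num M N}"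
  shows "P_term M N lam (2 * V_num M N - j) (2 * V_num M N - i) t = P_term M N lam i j t"
  using assms by (simp add: P_term_def p_phase_def sensor_pos_reflect)

text \<open>Since \<open>q_phase\<close> is even in the position, only the sign from exchanging
  \<open>i\<close> and \<open>j\<close> remains.\<close>

lemma Q_term_reflect:
  assumes "0 < M" "M < N" "coprime M N" "0 < lam" "i \<in> {1..U_num M N}" "j \<in> {1..U_num M N}"
  shows "Q_term M N lam (2 * V_num M N - j) (2 * V_num M N - i) t \<rho> = - Q_term M N lam i j t \<rho>"
  using assms by (simp add: Q_term_def q_phase_def sensor_pos_reflect flip: mult_minus_right of_real_minus)

lemma cnj_exp: "cnj (exp z) = exp (cnj z)"
  by (simp add: complex_eq_iff Re_exp Im_exp)

text \<open>Stated for an arbitrary list of columns, so that it covers \<open>B_mat\<close>,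
  \<open>A_mat\<close> and the single column in \<open>outer_self\<close>.\<close>

lemma mat_of_cols_times_adjoint:
  assumes "\<And>v. v \<in> set vs \<Longrightarrow> dim_vec v = n"
  shows "mat_of_cols n vs * mat_adjoint (mat_of_cols n vs) =
    mat n n (\<lambda>(i, j). \<Sum>v\<leftarrow>vs. v $ i * conjugate (v $ j))"
  using assms
  by (intro eq_matI)
    (auto simp: mat_adjoint_def scalar_prod_def mat_of_cols_index mat_of_rows_index
      sum_list_sum_nth intro!: sum.cong)

lemma vec1_index:
  "i < n \<Longrightarrow> vec1 n f $ i = f (i + 1)"
  by (simp add: vec1_def)

lemma outer_self_eq:
  "outer_self v = mat (dim_vec v) (dim_vec v) (\<lambda>(i, j). v $ i * cnj (v $ j))"
  unfolding outer_self_def by (subst mat_of_cols_times_adjoint) auto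

text \<open>Reduces the sum in the additive group of m by n matrices to ordinary entrywise sums, by
  induction on the index set.\<close>

lemma finsum_module_mat:
  fixes f :: "'b \<Rightarrow> 'a::comm_ring_1 mat"
  assumes "finite F" and "f \<in> F \<rightarrow> carrier_mat m n"
  shows "finsum (module_mat TYPE('a) m n) f F = mat m n (\<lambda>(i, j). \<Sum>k\<in>F. f k $$ (i, j))"
proof -
  interpret abelian_group "module_mat TYPE('a) m n"
    by (rule abelian_group_mat)
  show ?thesis
    using assms
  proof (induction F rule: finite_induct)
    case empty
    then show ?case by (auto simp: module_mat_simps)
  next
    case (insert x F)
    then have "f x \<in> carrier_mat m n" by auto
    with insert show ?case
      by (subst finsum_insert) (auto simp: module_mat_simps Pi_iff)
  qed
qed

lemma sum_list_map_upt_Suc: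
  "(\<Sum>k\<leftarrow>[m..<Suc n]. f k) = (\<Sum>k = m..n. f k)"
  for f :: "nat \<Rightarrow> 'a::comm_monoid_add"
  by (simp add: interv_sum_list_conv_sum_set_nat atLeastLessThanSuc_atLeastAtMost del: upt_Suc)

lemma dim_b_vec [simp]: "dim_vec (b_vec M N lam t \<rho>) = U_num M N"
  by (simp add: b_vec_def vec1_def)

lemma dim_a_vec [simp]: "dim_vec (a_vec M N lam t) = U_num M N"
  by (simp add: a_vec_def vec1_def)

text \<open>Conjugation negates the imaginary exponent of the \<open>j\<close>-th entry, so each
  product of entries has the phase differences as exponent.\<close>

lemma R_mat_eq:
  "R_mat M N lam K \<theta> r = mat1 (U_num M N) (U_num M N)
    (\<lambda>i j. \<Sum>k = 1..K. exp (P_term M N lam i j (\<theta> k) + Q_term M N lam i j (\<theta> k) (r k)))"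
  unfolding R_mat_def B_mat_def
  apply (subst mat_of_cols_times_adjoint)
   apply force
  apply (auto simp: mat1_def b_vec_def vec1_index o_def sum_list_map_upt_Suc cnj_exp
      P_term_def Q_term_def algebra_simps simp flip: exp_add simp del: upt_Suc
      intro!: sum.cong eq_matI)
  done

lemma A_mat_times_adjoint:
  "A_mat M N lam K \<theta> * mat_adjoint (A_mat M N lam K \<theta>) = mat (U_num M N) (U_num M N)
    (\<lambda>(i, j). \<Sum>k = 1..K. a_vec M N lam (\<theta> k) $ i * cnj (a_vec M N lam (\<theta> k) $ j))"
  unfolding A_mat_def
  by (subst mat_of_cols_times_adjoint)
    (force, simp add: o_def sum_list_map_upt_Suc del: upt_Suc)

text \<open>The doubled positions in \<open>a_vec\<close> double the phase, which produces the
  factor 2. The shift by 1 passes from vector indices to sensor numbers.\<close>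

lemma a_vec_times_cnj:
  assumes "i < U_num M N" "j < U_num M N"
  shows "a_vec M N lam t $ i * cnj (a_vec M N lam t $ j) =
    exp (2 * P_term M N lam (i + 1) (j + 1) t)"
  using assms
  by (simp add: a_vec_def vec1_index cnj_exp P_term_def p_phase_def algebra_simps
      flip: exp_add)

lemma Rd_mat_entry:
  assumes "0 < M" "M < N" "coprime M N" "0 < lam" "i \<in> {1..U_num M N}" "j \<in> {1..U_num M N}"
  shows "entry (Rd_mat M N lam K \<theta> r) i j =
    (\<Sum>k = 1..K. exp (P_term M N lam i j (\<theta> k) + Q_term M N lam i j (\<theta> k) (r k))) *
    (\<Sum>k = 1..K. exp (P_term M N lam i j (\<theta> k) - Q_term M N lam i j (\<theta> k) (r k)))"
proof -
  \<comment> \<open>The reflected indices stay in range, so the formula for \<open>R_mat\<close>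
    applies to them too.\<close>
  have refl: "2 * V_num M N - u \<in> {1..U_num M N}" if "u \<in> {1..U_num M N}" for u
    using that by (auto simp: U_num_def)
  have "entry (Rd_mat M N lam K \<theta> r) i j =
      entry (R_mat M N lam K \<theta> r) i j * entry (Ra_mat M N lam K \<theta> r) i j"
    using assms(5,6) by (auto simp: Rd_mat_def hadamard_def entry_def R_mat_eq mat1_def)
  also have "entry (Ra_mat M N lam K \<theta> r) i j =
      entry (R_mat M N lam K \<theta> r) (2 * V_num M N - j) (2 * V_num M N - i)"
    unfolding Ra_mat_def by (rule entry_mat1[OF assms(5,6)])
  finally show ?thesis
    using assms by (simp only: R_mat_eq entry_mat1 refl P_term_reflect Q_term_reflect) simp
qed

text \<open>Splits the double sum by whether the two indices agree. The outer index \<open>w\<close>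
  belongs to the second factor, as in \<open>C_mat\<close>.\<close>

lemma sum_product_diagonal:
  fixes f g :: "'b \<Rightarrow> 'a::comm_semiring_0"
  assumes "finite A"
  shows "sum f A * sum g A = (\<Sum>k\<in>A. f k * g k) + (\<Sum>w\<in>A. \<Sum>u\<in>A - {w}. f u * g w)"
proof -
  have "sum f A * sum g A = (\<Sum>w\<in>A. \<Sum>u\<in>A. f u * g w)"
    \<comment> \<open>Expanding puts the index of \<open>f\<close> outside; the swap moves the index
      of \<open>g\<close> there.\<close>
    by (simp only: sum_product) (rule sum.swap)
  also have "\<dots> = (\<Sum>w\<in>A. f w * g w + (\<Sum>u\<in>A - {w}. f u * g w))"
    using assms by (intro sum.cong refl sum.remove)
  finally show ?thesis by (simp add: sum.distrib)
qed

text \<open>For equal indices \<open>(P k + Q k) + (P k - Q k) = 2 * P k\<close>; for distinct ones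
  the difference \<open>Q u - Q w\<close> survives.\<close>

lemma exp_sums_product:
  fixes P Q :: "'b \<Rightarrow> 'a::{real_normed_field,banach}"
  assumes "finite A"
  shows "(\<Sum>k\<in>A. exp (P k + Q k)) * (\<Sum>k\<in>A. exp (P k - Q k)) =
    (\<Sum>k\<in>A. exp (2 * P k)) + (\<Sum>w\<in>A. \<Sum>u\<in>A - {w}. exp (P u + P w + Q u - Q w))"
  unfolding sum_product_diagonal[OF assms]
  by (simp add: algebra_simps flip: exp_add mult_2)

theorem lemma1:
  fixes M N K :: nat and lam :: real and \<theta> r :: "nat \<Rightarrow> real"
  assumes "0 < M" and "M < N" and "coprime M N"
    and "0 < lam"
    and "1 \<le> K"
    and "\<And>k. k \<in> {1..K} \<Longrightarrow> 0 < r k"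
    and "\<And>k. k \<in> {1..K} \<Longrightarrow>
           1.2 * aperture M N lam < r k \<and> r k < 2 * (aperture M N lam)\<^sup>2 / lam"
  shows "(\<forall>i \<in> {1..U_num M N}. \<forall>j \<in> {1..U_num M N}.
            entry (Rd_mat M N lam K \<theta> r) i j =
              (\<Sum>k = 1..K. exp (P_term M N lam i j (\<theta> k) + Q_term M N lam i j (\<theta> k) (r k))) *
              (\<Sum>k = 1..K. exp (P_term M N lam i j (\<theta> k) - Q_term M N lam i j (\<theta> k) (r k)))
          \<and> (\<Sum>k = 1..K. exp (P_term M N lam i j (\<theta> k) + Q_term M N lam i j (\<theta> k) (r k))) *
              (\<Sum>k = 1..K. exp (P_term M N lam i j (\<theta> k) - Q_term M N lam i j (\<theta> k) (r k))) =
              entry (S_mat M N lam K \<theta>) i j + entry (C_mat M N lam K \<theta> r) i j)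
       \<and> S_mat M N lam K \<theta> = A_mat M N lam K \<theta> * mat_adjoint (A_mat M N lam K \<theta>)
       \<and> A_mat M N lam K \<theta> * mat_adjoint (A_mat M N lam K \<theta>) =
           finsum (module_mat TYPE(complex) (U_num M N) (U_num M N))
             (\<lambda>k. outer_self (a_vec M N lam (\<theta> k))) {1..K}"
proof (intro conjI ballI)
  fix i j
  assume i: "i \<in> {1..U_num M N}" and j: "j \<in> {1..U_num M N}"
  show "entry (Rd_mat M N lam K \<theta> r) i j =
      (\<Sum>k = 1..K. exp (P_term M N lam i j (\<theta> k) + Q_term M N lam i j (\<theta> k) (r k))) *
      (\<Sum>k = 1..K. exp (P_term M N lam i j (\<theta> k) - Q_term M N lam i j (\<theta> k) (r k)))"
    using assms(1-4) i j by (rule Rd_mat_entry)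
  show "(\<Sum>k = 1..K. exp (P_term M N lam i j (\<theta> k) + Q_term M N lam i j (\<theta> k) (r k))) *
      (\<Sum>k = 1..K. exp (P_term M N lam i j (\<theta> k) - Q_term M N lam i j (\<theta> k) (r k))) =
      entry (S_mat M N lam K \<theta>) i j + entry (C_mat M N lam K \<theta> r) i j"
    by (simp only: S_mat_def C_mat_def entry_mat1[OF i j] exp_sums_product[OF finite_atLeastAtMost])
next
  show "S_mat M N lam K \<theta> = A_mat M N lam K \<theta> * mat_adjoint (A_mat M N lam K \<theta>)"
    by (auto simp: S_mat_def mat1_def A_mat_times_adjoint a_vec_times_cnj intro!: eq_matI)
  show "A_mat M N lam K \<theta> * mat_adjoint (A_mat M N lam K \<theta>) =
      finsum (module_mat TYPE(complex) (U_num M N) (U_num M N))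
        (\<lambda>k. outer_self (a_vec M N lam (\<theta> k))) {1..K}"
    by (subst finsum_module_mat) (auto simp: A_mat_times_adjoint outer_self_eq intro!: eq_matI)
qed

end
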